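(* Let $m\ge 1$, $M=2^m$, $L\ge 2$, and let $\pi_1,\dots,\pi_L$ be distinct permutations of $\{1,\dots,m\}$. Let $\Phi=\frac{1}{\sqrt M}[\Phi_1,\dots,\Phi_L]$ be the associated $M\times LM$ binary Golay spreading matrix, and for $k_1\ne k_2$ let $B_{k_1,k_2}$ be the symplectic matrix over $\mathbb{Z}_2$ associated with the pair $(\pi_{k_1},\pi_{k_2})$. If $$r_{\min}=\min_{1\le k_1\ne k_2\le L}\operatorname{rank}_2(B_{k_1,k_2}),$$ then the coherence of $\Phi$ is $$\mu(\Phi)=\frac{1}{\sqrt{2^{r_{\min}}}}.$$
   Context: $\mathbb{Z}_2=\{0,1\}$ with addition modulo 2. For a permutation $\pi$ of $\{1,\dots,m\}$ define the quadratic form $\mathcal{Q}_\pi(x)=\sum_{r=1}^{m-1}x_{\pi(r)}x_{\pi(r+1)}$ over $\mathbb{Z}_2$, $x=(x_1,\dots,x_m)\in\mathbb{Z}_2^m$. For $0\le c\le 2^m-1$ with $c=\sum_{r=1}^m v_r2^{r-1}$, $v_r\in\mathbb{Z}_2$, let $\mathcal{L}_c(x)=\sum_{r=1}^m v_rx_r$ (mod 2). Let $M=2^m$. For $0\le i\le M-1$ write $i=\sum_{l=1}^m i_l2^{l-1}$ with $i_l\in\mathbb{Z}_2$. Let $b_\pi^{(c)}\in\{\pm1\}^M$ be the real column vector whose $i$-th entry is $(-1)^{\mathcal{Q}_\pi(i_1,\dots,i_m)+\mathcal{L}_c(i_1,\dots,i_m)}$. For permutations $\pi_1,\dots,\pi_L$,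 put $\Phi_k=[b_{\pi_k}^{(0)},b_{\pi_k}^{(1)},\dots,b_{\pi_k}^{(M-1)}]$ (an $M\times M$ matrix) and $\Phi=\frac1{\sqrt M}[\Phi_1,\dots,\Phi_L]$. The coherence of a matrix $A$ with nonzero columns $\phi_1,\dots,\phi_N$ is $\mu(A)=\max_{1\le j_1\ne j_2\le N}\frac{|\langle\phi_{j_1},\phi_{j_2}\rangle|}{\|\phi_{j_1}\|_2\|\phi_{j_2}\|_2}$ (maximum over distinct column indices). For each $k$, let $Q_k$ be the $m\times m$ strictly upper triangular matrix over $\mathbb{Z}_2$ with $\mathcal{Q}_{\pi_k}(x)=xQ_kx^T$ (i.e. the $(i,j)$ entry, $i<j$, is 1 iff $x_ix_j$ occurs in $\mathcal{Q}_{\pi_k}$). For $k_1\ne k_2$ let $Q_{k_1,k_2}=Q_{k_1}+Q_{k_2}$ and $B_{k_1,k_2}=Q_{k_1,k_2}+Q_{k_1,k_2}^T$ (over $\mathbb{Z}_2$). $\operatorname{rank}_2$ denotes rank over $\mathbb{Z}_2$. *)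

theory Defs
  imports
    Complex_Main
    "HOL-Library.Z2"
    "HOL-Combinatorics.Permutations"
    "Jordan_Normal_Form.DL_Rank"
begin

text \<open>
  Permutations of \<open>{1, \<dots>, m}\<close> are functions \<open>p\<close> with \<^term>\<open>p permutes {1..m}\<close>, and a point
  \<open>(x\<^sub>1, \<dots>, x\<^sub>m)\<close> over the two-element field \<^typ>\<open>bit\<close> is a function of which only the values
  on \<open>{1, \<dots>, m}\<close> are used. Matrices and vectors are indexed from 0.
\<close>

definition quad_form :: "nat \<Rightarrow> (nat \<Rightarrow> nat) \<Rightarrow> (nat \<Rightarrow> bit) \<Rightarrow> bit" where
  "quad_form m p x = (\<Sum>r = 1..m - 1. x (p r) * x (p (r + 1)))"

text \<open>\<open>digit n l\<close> is the coefficient of \<open>2 ^ (l - 1)\<close> in the binary expansion of \<open>n\<close>, for \<open>l \<ge> 1\<close>.\<close>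

definition digit :: "nat \<Rightarrow> nat \<Rightarrow> bit" where
  "digit n l = of_bool (bit n (l - 1))"

definition lin_form :: "nat \<Rightarrow> nat \<Rightarrow> (nat \<Rightarrow> bit) \<Rightarrow> bit" where
  "lin_form m c x = (\<Sum>r = 1..m. digit c r * x r)"

definition golay_vec :: "nat \<Rightarrow> (nat \<Rightarrow> nat) \<Rightarrow> nat \<Rightarrow> real vec" where
  "golay_vec m p c =
     vec (2 ^ m) (\<lambda>i. if quad_form m p (digit i) + lin_form m c (digit i) = 0 then 1 else - 1)"

definition golay_block :: "nat \<Rightarrow> (nat \<Rightarrow> nat) \<Rightarrow> real mat" where
  "golay_block m p = mat_of_cols (2 ^ m) (map (golay_vec m p) [0..<2 ^ m])"

text \<open>
  Column \<open>j\<close> of the concatenation of \<open>L\<close> blocks of width \<open>2 ^ m\<close> is column \<open>j mod 2 ^ m\<close> of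
  block number \<open>j div 2 ^ m + 1\<close>, as the blocks are numbered from 1 to \<open>L\<close>.
\<close>

definition golay_spreading_matrix :: "nat \<Rightarrow> nat \<Rightarrow> (nat \<Rightarrow> nat \<Rightarrow> nat) \<Rightarrow> real mat" where
  "golay_spreading_matrix m L p = (1 / sqrt (2 ^ m)) \<cdot>\<^sub>m
     mat (2 ^ m) (L * 2 ^ m)
       (\<lambda>(i, j). golay_block m (p (j div 2 ^ m + 1)) $$ (i, j mod 2 ^ m))"

definition l2_norm :: "real vec \<Rightarrow> real" where
  "l2_norm v = sqrt (v \<bullet> v)"

text \<open>Only meaningful for matrices with at least two columns, all of them nonzero.\<close>

definition coherence :: "real mat \<Rightarrow> real" where
  "coherence A = Max {\<bar>col A i \<bullet> col A j\<bar> / (l2_norm (col A i) * l2_norm (col A j)) | i j.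
     i < dim_col A \<and> j < dim_col A \<and> i \<noteq> j}"

text \<open>
  For \<open>i < j\<close>, the entry at the 0-based position \<open>(i, j)\<close> is 1 iff the monomial
  \<open>x (i + 1) * x (j + 1)\<close> occurs in the quadratic form. The consecutive pairs \<open>{p r, p (r + 1)}\<close> are pairwise different, so no two of these monomials cancel.
\<close>

definition quad_mat :: "nat \<Rightarrow> (nat \<Rightarrow> nat) \<Rightarrow> bit mat" where
  "quad_mat m p = mat m m
     (\<lambda>(i, j). of_bool (i < j \<and> (\<exists>r\<in>{1..m - 1}. {p r, p (r + 1)} = {i + 1, j + 1})))"

lemma consecutive_pair_unique:
  fixes m :: nat
  assumes p: "p permutes {1..m}" and r: "r \<in> {1..m - 1}" "s \<in> {1..m - 1}"
    and eq: "{p r, p (r + 1)} = {p s, p (s + 1)}"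
  shows "r = s"
proof -
  have "p ` {r, r + 1} = p ` {s, s + 1}"
    using eq by simp
  then have "{r, r + 1} = {s, s + 1}"
    using permutes_inj[OF p] by (simp only: inj_image_eq_iff)
  then show ?thesis
    unfolding doubleton_eq_iff by linarith
qed

lemma quad_form_eq_quad_mat:
  assumes p: "p permutes {1..m}"
  defines "v x \<equiv> vec m (\<lambda>i. x (i + 1))"
  shows "quad_form m p x = v x \<bullet> (quad_mat m p *\<^sub>v v x)"
proof -
  let ?P = "\<lambda>r i j. i < j \<and> {p r, p (r + 1)} = {i + 1, j + 1}"
  have ent: "quad_mat m p $$ (i, j) = (\<Sum>r = 1..m - 1. of_bool (?P r i j))" if "i < m" "j < m" for i j
  proof (cases "\<exists>r\<in>{1..m - 1}. ?P r i j")
    case True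
    then obtain s where s: "s \<in> {1..m - 1}" "?P s i j" by blast
    then have "?P r i j \<longleftrightarrow> r = s" if "r \<in> {1..m - 1}" for r
      using consecutive_pair_unique[OF p that s(1)] by auto
    then have "(\<Sum>r = 1..m - 1. of_bool (?P r i j)) = (\<Sum>r = 1..m - 1. if r = s then 1 else 0 :: bit)"
      by (intro sum.cong refl) simp
    also have "\<dots> = 1" using s(1) by simp
    finally show ?thesis using that True by (simp add: quad_mat_def)
  next
    case False
    then have "(\<Sum>r = 1..m - 1. of_bool (?P r i j)) = (0 :: bit)"
      by (intro sum.neutral) auto
    then show ?thesis using that False by (auto simp: quad_mat_def)
  qed
  have inner: "(\<Sum>i<m. \<Sum>j<m. of_bool (?P r i j) * (x (i + 1) * x (j + 1))) = x (p r) * x (p (r + 1))"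
    if r: "r \<in> {1..m - 1}" for r
  proof -
    have pr: "p r \<in> {1..m}" "p (r + 1) \<in> {1..m}"
      using r unfolding permutes_in_image[OF p] by auto
    have ne: "p r \<noteq> p (r + 1)"
      by (simp add: inj_eq[OF permutes_inj[OF p]])
    define a b where "a = min (p r) (p (r + 1)) - 1" and "b = max (p r) (p (r + 1)) - 1"
    have ab: "a < m" "b < m"
      using pr by (auto simp: a_def b_def)
    have pairs: "{p r, p (r + 1)} = {a + 1, b + 1}"
      using pr unfolding a_def b_def by (cases "p r \<le> p (r + 1)") (simp_all add: insert_commute)
    have "a < b"
      using pr ne by (cases "p r < p (r + 1)") (auto simp: a_def b_def)
    then have P: "?P r i j \<longleftrightarrow> i = a \<and> j = b" for i j
      unfolding pairs doubleton_eq_iff by linarith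
    have "(\<Sum>i<m. \<Sum>j<m. of_bool (?P r i j) * (x (i + 1) * x (j + 1)))
        = (\<Sum>i<m. \<Sum>j<m. if j = b then (if i = a then x (a + 1) * x (b + 1) else 0) else 0)"
      unfolding P by (intro sum.cong refl) auto
    also have "\<dots> = x (a + 1) * x (b + 1)"
      using ab by simp
    also have "\<dots> = x (p r) * x (p (r + 1))"
      using pr by (cases "p r \<le> p (r + 1)") (auto simp: a_def b_def min_def max_def mult.commute)
    finally show ?thesis .
  qed
  have "v x \<bullet> (quad_mat m p *\<^sub>v v x)
      = (\<Sum>i<m. \<Sum>j<m. quad_mat m p $$ (i, j) * (x (i + 1) * x (j + 1)))"
  proof -
    have dim: "dim_row (quad_mat m p) = m" "dim_col (quad_mat m p) = m"
      by (simp_all add: quad_mat_def)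
    have "(quad_mat m p *\<^sub>v v x) $ i = (\<Sum>j<m. quad_mat m p $$ (i, j) * x (j + 1))" if "i < m" for i
      using that dim by (auto simp: v_def scalar_prod_def lessThan_atLeast0 intro!: sum.cong)
    then have "v x \<bullet> (quad_mat m p *\<^sub>v v x)
        = (\<Sum>i<m. x (i + 1) * (\<Sum>j<m. quad_mat m p $$ (i, j) * x (j + 1)))"
      unfolding scalar_prod_def using dim
      by (auto simp: v_def lessThan_atLeast0 intro!: sum.cong)
    then show ?thesis
      by (simp only: sum_distrib_left mult.left_commute)
  qed
  also have "\<dots> = (\<Sum>i<m. \<Sum>j<m. \<Sum>r = 1..m - 1. of_bool (?P r i j) * (x (i + 1) * x (j + 1)))"
    by (intro sum.cong refl) (simp only: ent lessThan_iff sum_distrib_right)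
  also have "\<dots> = (\<Sum>i<m. \<Sum>r = 1..m - 1. \<Sum>j<m. of_bool (?P r i j) * (x (i + 1) * x (j + 1)))"
    by (intro sum.cong refl sum.swap)
  also have "\<dots> = (\<Sum>r = 1..m - 1. \<Sum>i<m. \<Sum>j<m. of_bool (?P r i j) * (x (i + 1) * x (j + 1)))"
    by (rule sum.swap)
  also have "\<dots> = quad_form m p x"
    unfolding quad_form_def by (intro sum.cong refl inner)
  finally show ?thesis ..
qed

definition symplectic_mat :: "nat \<Rightarrow> (nat \<Rightarrow> nat) \<Rightarrow> (nat \<Rightarrow> nat) \<Rightarrow> bit mat" where
  "symplectic_mat m p q =
     (let Q = quad_mat m p + quad_mat m q in Q + transpose_mat Q)"

definition rank2 :: "bit mat \<Rightarrow> nat" where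
  "rank2 B = vec_space.rank (dim_row B) B"

end

theory Submission
  imports Defs "HOL-Library.Cardinality"
begin

text \<open>
  The inner product of two columns is a sum \<open>S(w) = (\<Sum>v. (-1)\<^bsup>vQv + wv\<^esup>)\<close> over
  the vectors \<open>v\<close> of length \<open>m\<close>, where \<open>Q\<close> is the sum of the two quadratic matrices and \<open>w\<close> is the
  sum of the two linear labels. Squaring and substituting \<open>u\<close> for the difference of the two summation
  variables turns \<open>S(w)\<^sup>2\<close> into \<open>2\<^sup>m\<close> times a sum over the kernel of
  \<open>B = Q + Q\<^sup>T\<close>, on which \<open>vQv + wv\<close> is additive. Hence \<open>S(w)\<^sup>2\<close> is
  either 0 or \<open>2\<^sup>2\<^sup>m\<^sup>-\<^sup>r\<close> with \<open>r\<close> the rank of \<open>B\<close>. The second value is attained because the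
  sum of \<open>S(w)\<close> over all \<open>w\<close> is \<open>2\<^sup>m\<close>. Within a block \<open>Q = 0\<close> and the columns are orthogonal.
\<close>

section \<open>Cardinality of the column space over a finite field\<close>

context vec_space
begin

text \<open>Independence gives each vector of the span exactly one coefficient function on
  \<open>U\<close>, so counting these functions counts the span.\<close>

lemma card_span_lin_indpt:
  assumes U: "U \<subseteq> carrier_vec n" "finite U" and indpt: "lin_indpt U"
  shows "card (span U) = CARD('a) ^ card U"
proof -
  have span: "span U = (\<lambda>a. lincomb a U) ` (U \<rightarrow>\<^sub>E UNIV)"
  proof -
    \<comment> \<open>Only the values on \<open>U\<close> matter; restricting makes the coefficient
      functions extensional, hence countable by \<open>card_PiE\<close>.\<close>
    have "lincomb a U = lincomb (restrict a U) U" for a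
      using U by (intro eq_vecI) (auto simp: lincomb_index lincomb_dim)
    then show ?thesis
      using finite_span[of U] U by (auto simp: image_iff) (metis UNIV_I restrict_PiE_iff)
  qed
  have "inj_on (\<lambda>a. lincomb a U) (U \<rightarrow>\<^sub>E UNIV)"
  proof (rule inj_onI, rule ccontr)
    fix a b assume ab: "a \<in> U \<rightarrow>\<^sub>E UNIV" "b \<in> U \<rightarrow>\<^sub>E UNIV"
      and eq: "lincomb a U = lincomb b U" and "a \<noteq> b"
    then obtain v where v: "v \<in> U" "a v \<noteq> b v"
      by (metis PiE_ext)
    have "lincomb (\<lambda>x. a x - b x) U = 0\<^sub>v n"
    proof (rule eq_vecI)
      fix i assume "i < dim_vec (0\<^sub>v n :: 'a vec)"
      then have i: "i < n" by simp
      have "(\<Sum>x\<in>U. a x * x $ i) = (\<Sum>x\<in>U. b x * x $ i)"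
        using arg_cong[OF eq, of "\<lambda>v. v $ i"] i U by (simp add: lincomb_index)
      then show "lincomb (\<lambda>x. a x - b x) U $ i = 0\<^sub>v n $ i"
        using i U by (simp add: lincomb_index left_diff_distrib sum_subtractf)
    qed (use U in \<open>simp add: lincomb_dim\<close>)
    then have "lin_dep U"
      using v U by (intro lin_dep_crit[where A = U and a = "\<lambda>x. a x - b x" and v = v]) auto
    with indpt show False by simp
  qed
  then show ?thesis
    unfolding span using U by (simp add: card_image card_PiE)
qed

text \<open>A maximal independent set of columns has \<open>rank A\<close> elements, and by
  maximality every other column lies in its span.\<close>

lemma card_col_space:
  assumes A: "A \<in> carrier_mat n nc"
  shows "card (col_space A) = CARD('a) ^ rank A"
proof -
  have C: "set (cols A) \<subseteq> carrier_vec n"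
    using cols_dim A by blast
  obtain U where U: "maximal U (\<lambda>T. T \<subseteq> set (cols A) \<and> lin_indpt T)"
    using maximal_exists_superset[of "set (cols A)" "\<lambda>T. T \<subseteq> set (cols A) \<and> lin_indpt T" "{}"]
      finite_lin_indpt2[of "{}"] by auto
  then have UC: "U \<subseteq> set (cols A)" and indpt: "lin_indpt U"
    by (auto simp: maximal_def)
  then have U': "U \<subseteq> carrier_vec n" "finite U"
    using C finite_subset by auto
  have "x \<in> span U" if "x \<in> set (cols A)" for x
  proof (cases "x \<in> U")
    case True
    then show ?thesis using U' in_own_span by auto
  next
    case False
    then have "\<not> lin_indpt (U \<union> {x})"
      using U UC that unfolding maximal_def by blast
    then show ?thesis
      using lin_dep_iff_in_span[OF _ indpt _ False] U' C that by auto
  qed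
  then have "span (set (cols A)) = span U"
    using span_is_subset[of "set (cols A)" "span U"] span_is_submodule[of U]
      span_is_monotone[OF UC] U' by (metis carrier_vec_def module_vec_simps(3) subsetI subset_antisym)
  then show ?thesis
    unfolding col_space_def rank_card_indpt[OF A U]
    using card_span_lin_indpt[OF U' indpt] by simp
qed

end

section \<open>Characters of the two-element field\<close>

definition bit_char :: "bit \<Rightarrow> real" where
  "bit_char b = (if b = 0 then 1 else - 1)"

lemma bit_char_add: "bit_char (a + b) = bit_char a * bit_char b"
  by (cases a; cases b) (simp_all add: bit_char_def)

lemma bit_char_0 [simp]: "bit_char 0 = 1"
  and bit_char_1 [simp]: "bit_char 1 = - 1"
  by (simp_all add: bit_char_def)

lemma add_self_bit_vec: "u \<in> carrier_vec n \<Longrightarrow> u + u = (0\<^sub>v n :: bit vec)"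
  by (intro eq_vecI) auto

lemma add_add_self_bit_vec:
  "v \<in> carrier_vec n \<Longrightarrow> u \<in> carrier_vec n \<Longrightarrow> v + u + u = (v :: bit vec)"
  by (simp add: assoc_add_vec[of v n u u] add_self_bit_vec)

text \<open>Translation by \<open>u\<close> is its own inverse, since \<open>u + u\<close> vanishes
  in characteristic 2.\<close>

lemma bij_betw_translate_bit_vec:
  assumes K: "K \<subseteq> carrier_vec n" and closed: "\<And>u v. u \<in> K \<Longrightarrow> v \<in> K \<Longrightarrow> u + v \<in> K"
    and u: "(u :: bit vec) \<in> K"
  shows "bij_betw (\<lambda>v. v + u) K K"
proof -
  have "v + u + u = v" if "v \<in> K" for v
    using that K u by (intro add_add_self_bit_vec) auto
  then show ?thesis
    using closed u by (intro bij_betw_byWitness[where f' = "\<lambda>v. v + u"]) auto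
qed

text \<open>The translation by a vector where \<open>h\<close> is 1 negates the sum.\<close>

lemma sum_bit_char_additive:
  assumes K: "K \<subseteq> carrier_vec n" and closed: "\<And>u v. u \<in> K \<Longrightarrow> v \<in> K \<Longrightarrow> u + v \<in> K"
    and h: "\<And>u v. u \<in> K \<Longrightarrow> v \<in> K \<Longrightarrow> h (u + v :: bit vec) = h u + h v"
  shows "(\<Sum>v\<in>K. bit_char (h v)) = (if \<forall>v\<in>K. h v = 0 then real (card K) else 0)"
proof (cases "\<forall>v\<in>K. h v = 0")
  case False
  then obtain u where u: "u \<in> K" "h u = 1" by auto
  have "(\<Sum>v\<in>K. bit_char (h v)) = (\<Sum>v\<in>K. bit_char (h (v + u)))"
    by (rule sum.reindex_bij_betw[symmetric])
      (use bij_betw_translate_bit_vec[OF K closed u(1)] in auto)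
  also have "\<dots> = (\<Sum>v\<in>K. - bit_char (h v))"
    using u h by (intro sum.cong) (auto simp: bit_char_add)
  finally show ?thesis
    using False by (auto simp: sum_negf)
qed auto

section \<open>Binary expansions as vectors\<close>

definition bits :: "nat \<Rightarrow> nat \<Rightarrow> bit vec" where
  "bits m i = vec m (\<lambda>k. digit i (k + 1))"

lemma bits_carrier [simp]: "bits m i \<in> carrier_vec m"
  by (simp add: bits_def)

lemma bits_add: "bits m i + bits m j = bits m (xor i j)"
  by (intro eq_vecI) (auto simp: bits_def digit_def bit_xor_iff)

lemma bij_betw_bits: "bij_betw (bits m) {..<2 ^ m} (carrier_vec m)"
  unfolding bij_betw_def
proof
  show "inj_on (bits m) {..<2 ^ m}"
  proof (rule inj_onI)
    fix i j assume ij: "i \<in> {..<2 ^ m}" "j \<in> {..<2 ^ m}" and eq: "bits m i = bits m j"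
    have "bit i k = bit j k" if "k < m" for k
      using arg_cong[OF eq, of "\<lambda>v. v $ k"] that
      by (simp add: bits_def digit_def of_bool_def split: if_splits)
    then have "take_bit m i = take_bit m j"
      by (auto intro!: bit_eqI simp: bit_take_bit_iff)
    then show "i = j"
      using ij by (simp add: take_bit_nat_eq_self)
  qed
  show "bits m ` {..<2 ^ m} = carrier_vec m"
  proof (intro equalityI subsetI)
    fix v :: "bit vec" assume v: "v \<in> carrier_vec m"
    \<comment> \<open>The preimage is the number whose binary digit of weight \<open>2 ^ k\<close>
      is \<open>v $ k\<close>.\<close>
    define i :: nat where "i = horner_sum of_bool 2 (map (\<lambda>k. v $ k = 1) [0..<m])"
    have "bits m i = v"
      using v by (intro eq_vecI) (auto simp: bits_def digit_def i_def bit_horner_sum_bit_iff)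
    moreover have "i < 2 ^ m"
      unfolding i_def using horner_sum_of_bool_2_less[of "map (\<lambda>k. v $ k = 1) [0..<m]"] by simp
    ultimately show "v \<in> bits m ` {..<2 ^ m}" by auto
  qed auto
qed

lemma finite_carrier_bit_vec [simp]: "finite (carrier_vec m :: bit vec set)"
  using bij_betw_finite[OF bij_betw_bits] by auto

lemma card_carrier_bit_vec: "card (carrier_vec m :: bit vec set) = 2 ^ m"
  using bij_betw_same_card[OF bij_betw_bits] by simp

section \<open>Rank and nullity over the two-element field\<close>

lemma card_UNIV_bit: "CARD(bit) = 2"
proof -
  have "(UNIV :: bit set) = {0, 1}"
    using bit.exhaust by auto
  then show ?thesis by (metis card_2_iff zero_neq_one)
qed

text \<open>Every nonempty fibre of \<open>B\<close> is a translate of the kernel, and the fibres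
  are indexed by the column space, which has \<open>2 ^ rank2 B\<close> elements.\<close>

lemma rank_nullity_bit:
  fixes B :: "bit mat"
  assumes B: "B \<in> carrier_mat n m"
  shows "card {v \<in> carrier_vec m. B *\<^sub>v v = 0\<^sub>v n} * 2 ^ rank2 B = 2 ^ m"
proof -
  interpret vec_space "TYPE(bit)" n .
  let ?K = "{v \<in> carrier_vec m. B *\<^sub>v v = 0\<^sub>v n}"
  let ?R = "(\<lambda>v. B *\<^sub>v v) ` carrier_vec m"
  have R: "?R = col_space B"
    using B by (subst col_space_eq[OF B]) auto
  have fibre: "card {v \<in> carrier_vec m. B *\<^sub>v v = y} = card ?K" if yR: "y \<in> ?R" for y
  proof -
    obtain u where u: "u \<in> carrier_vec m" "y = B *\<^sub>v u"
      using yR by blast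
    have y: "y \<in> carrier_vec n"
      using u B by simp
    have "bij_betw (\<lambda>v. v + u) ?K {v \<in> carrier_vec m. B *\<^sub>v v = y}"
      using u B y
      by (intro bij_betw_byWitness[where f' = "\<lambda>v. v + u"])
        (auto simp: add_add_self_bit_vec mult_add_distrib_mat_vec[OF B] add_self_bit_vec)
    then show ?thesis
      using bij_betw_same_card by fastforce
  qed
  have "(2 :: nat) ^ m = (\<Sum>v\<in>(carrier_vec m :: bit vec set). 1)"
    by (simp add: card_carrier_bit_vec)
  also have "\<dots> = (\<Sum>y\<in>?R. \<Sum>v\<in>{v \<in> carrier_vec m. B *\<^sub>v v = y}. 1)"
    by (rule sum.image_gen) simp
  also have "\<dots> = (\<Sum>y\<in>?R. card ?K)"
    using fibre by (intro sum.cong) auto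
  also have "\<dots> = card ?K * 2 ^ rank B"
    using card_col_space[OF B] by (simp add: R card_UNIV_bit)
  finally show ?thesis
    using B by (simp add: rank2_def)
qed

section \<open>Quadratic exponential sums\<close>

definition quad_sum :: "nat \<Rightarrow> bit mat \<Rightarrow> bit vec \<Rightarrow> real" where
  "quad_sum m Q w = (\<Sum>v\<in>carrier_vec m. bit_char (v \<bullet> (Q *\<^sub>v v) + w \<bullet> v))"

lemma bit_vec_separated:
  fixes w :: "bit vec"
  assumes w: "w \<in> carrier_vec m" "\<forall>v\<in>carrier_vec m. w \<bullet> v = 0"
  shows "w = 0\<^sub>v m"
proof (rule eq_vecI)
  fix i assume "i < dim_vec (0\<^sub>v m :: bit vec)"
  then show "w $ i = 0\<^sub>v m $ i"
    using w(2)[rule_format, of "unit_vec m i"] w(1) by simp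
qed (use w in simp)

text \<open>Orthogonality of characters: a linear form that is not identically zero takes both
  values equally often.\<close>

lemma sum_bit_char_linear:
  assumes w: "w \<in> carrier_vec m"
  shows "(\<Sum>v\<in>carrier_vec m. bit_char (w \<bullet> v)) = (if w = 0\<^sub>v m then 2 ^ m else 0)"
proof -
  have "(\<forall>v\<in>carrier_vec m. w \<bullet> v = 0) \<longleftrightarrow> w = 0\<^sub>v m"
    using bit_vec_separated[OF w] by auto
  then show ?thesis
    using sum_bit_char_additive[of "carrier_vec m" m "\<lambda>v. w \<bullet> v"] w
    by (simp add: scalar_prod_add_distrib card_carrier_bit_vec)
qed

text \<open>Serves for two columns of the same block, whose quadratic matrices cancel modulo
  2.\<close>

lemma quad_sum_zero_mat:
  assumes "w \<in> carrier_vec m"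
  shows "quad_sum m (0\<^sub>m m m) w = (if w = 0\<^sub>v m then 2 ^ m else 0)"
proof -
  have "quad_sum m (0\<^sub>m m m) w = (\<Sum>v\<in>carrier_vec m. bit_char (w \<bullet> v))"
  proof -
    have "0\<^sub>m m m *\<^sub>v v = (0\<^sub>v m :: bit vec)" if "v \<in> carrier_vec m" for v
      using that by (intro eq_vecI) auto
    then show ?thesis
      unfolding quad_sum_def by (intro sum.cong) auto
  qed
  then show ?thesis
    using sum_bit_char_linear[OF assms] by simp
qed

section \<open>Square of the quadratic sum and the polar form\<close>

context
  fixes m :: nat and Q :: "bit mat"
  assumes Q: "Q \<in> carrier_mat m m"
begin

text \<open>Expansion leaves the cross terms \<open>u \<bullet> (Q *\<^sub>v v)\<close> and
  \<open>v \<bullet> (Q *\<^sub>v u)\<close>; moving \<open>Q\<close> to the other side in the first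
  one, as a transpose, combines them into the polar form.\<close>

lemma quad_polarization:
  assumes u: "u \<in> carrier_vec m" and v: "v \<in> carrier_vec m"
  shows "(u + v) \<bullet> (Q *\<^sub>v (u + v)) = u \<bullet> (Q *\<^sub>v u) + v \<bullet> (Q *\<^sub>v v) + ((Q + Q\<^sup>T) *\<^sub>v u) \<bullet> v"
proof -
  have Qu: "Q *\<^sub>v u \<in> carrier_vec m" and Qv: "Q *\<^sub>v v \<in> carrier_vec m"
    and Qt: "Q\<^sup>T \<in> carrier_mat m m" and Qtu: "Q\<^sup>T *\<^sub>v u \<in> carrier_vec m"
    using Q u v by auto
  have "((Q + Q\<^sup>T) *\<^sub>v u) \<bullet> v = v \<bullet> (Q *\<^sub>v u) + u \<bullet> (Q *\<^sub>v v)"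
    unfolding add_mult_distrib_mat_vec[OF Q Qt u] add_scalar_prod_distrib[OF Qu Qtu v]
      transpose_vec_mult_scalar[OF Q v u] comm_scalar_prod[OF v Qu] ..
  moreover have "(u + v) \<bullet> (Q *\<^sub>v (u + v)) = u \<bullet> (Q *\<^sub>v u) + v \<bullet> (Q *\<^sub>v u) + (u \<bullet> (Q *\<^sub>v v) + v \<bullet> (Q *\<^sub>v v))"
    unfolding mult_add_distrib_mat_vec[OF Q u v] scalar_prod_add_distrib[OF add_carrier_vec[OF u v] Qu Qv]
      add_scalar_prod_distrib[OF u v Qu] add_scalar_prod_distrib[OF u v Qv] ..
  ultimately show ?thesis
    by (simp only: ac_simps)
qed

abbreviation (input) "ker_polar \<equiv> {u \<in> carrier_vec m. (Q + Q\<^sup>T) *\<^sub>v u = 0\<^sub>v m}"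

lemma quad_sum_square_kernel:
  assumes w: "w \<in> carrier_vec m"
  shows "(quad_sum m Q w)\<^sup>2 = 2 ^ m * (\<Sum>u\<in>ker_polar. bit_char (u \<bullet> (Q *\<^sub>v u) + w \<bullet> u))"
proof -
  let ?V = "carrier_vec m :: bit vec set"
  let ?f = "\<lambda>v. v \<bullet> (Q *\<^sub>v v) + w \<bullet> v"
  have B: "(Q + Q\<^sup>T) *\<^sub>v u \<in> ?V" if "u \<in> ?V" for u
    using Q that by (intro mult_mat_vec_carrier[of _ m m]) auto
  \<comment> \<open>After polarization the sign of \<open>?f v\<close> occurs twice and squares to
    1; what still depends on \<open>v\<close> is linear in \<open>v\<close>.\<close>
  have f: "bit_char (?f v) * bit_char (?f (u + v)) = bit_char (?f u) * bit_char (((Q + Q\<^sup>T) *\<^sub>v u) \<bullet> v)"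
    if "u \<in> ?V" "v \<in> ?V" for u v
    using that w
    by (simp add: quad_polarization scalar_prod_add_distrib[OF w] bit_char_add del: add_bit_eq_xor)
      (simp add: bit_char_def)
  have "(quad_sum m Q w)\<^sup>2 = (\<Sum>v\<in>?V. \<Sum>x\<in>?V. bit_char (?f v) * bit_char (?f x))"
    by (simp add: quad_sum_def power2_eq_square sum_product)
  also have "\<dots> = (\<Sum>v\<in>?V. \<Sum>u\<in>?V. bit_char (?f v) * bit_char (?f (u + v)))"
    by (intro sum.cong refl sum.reindex_bij_betw[symmetric] bij_betw_translate_bit_vec[of _ m]) auto
  also have "\<dots> = (\<Sum>v\<in>?V. \<Sum>u\<in>?V. bit_char (?f u) * bit_char (((Q + Q\<^sup>T) *\<^sub>v u) \<bullet> v))"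
    using f by (intro sum.cong) auto
  also have "\<dots> = (\<Sum>u\<in>?V. \<Sum>v\<in>?V. bit_char (?f u) * bit_char (((Q + Q\<^sup>T) *\<^sub>v u) \<bullet> v))"
    by (rule sum.swap)
  \<comment> \<open>The inner sum over \<open>v\<close> is a full character sum, which vanishes
    unless \<open>u\<close> lies in the kernel.\<close>
  also have "\<dots> = (\<Sum>u\<in>?V. bit_char (?f u) * (if (Q + Q\<^sup>T) *\<^sub>v u = 0\<^sub>v m then 2 ^ m else 0))"
    using sum_bit_char_linear[OF B] by (intro sum.cong) (auto simp flip: sum_distrib_left)
  also have "\<dots> = (\<Sum>u\<in>ker_polar. bit_char (?f u) * 2 ^ m)"
    by (intro sum.mono_neutral_cong_right) auto
  finally show ?thesis
    by (simp add: sum_distrib_left mult.commute)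
qed

lemma quad_sum_square:
  assumes w: "w \<in> carrier_vec m" and nz: "quad_sum m Q w \<noteq> 0"
  shows "(quad_sum m Q w)\<^sup>2 = (2 ^ m)\<^sup>2 / 2 ^ rank2 (Q + Q\<^sup>T)"
proof -
  have B: "Q + Q\<^sup>T \<in> carrier_mat m m"
    using Q by simp
  \<comment> \<open>The cross term of \<open>quad_polarization\<close> vanishes on the kernel, so
    the exponent is additive there.\<close>
  have "(\<Sum>u\<in>ker_polar. bit_char (u \<bullet> (Q *\<^sub>v u) + w \<bullet> u))
      = (if \<forall>u\<in>ker_polar. u \<bullet> (Q *\<^sub>v u) + w \<bullet> u = 0 then real (card ker_polar) else 0)"
    using w by (intro sum_bit_char_additive[of _ m])
      (auto simp: mult_add_distrib_mat_vec[OF B] quad_polarization scalar_prod_add_distrib[of w m]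
        simp del: add_bit_eq_xor)
  moreover have "(\<Sum>u\<in>ker_polar. bit_char (u \<bullet> (Q *\<^sub>v u) + w \<bullet> u)) \<noteq> 0"
    using quad_sum_square_kernel[OF w] nz by auto
  ultimately have "(quad_sum m Q w)\<^sup>2 = 2 ^ m * real (card ker_polar)"
    unfolding quad_sum_square_kernel[OF w] by presburger
  moreover have "real (card ker_polar) * 2 ^ rank2 (Q + Q\<^sup>T) = 2 ^ m"
    using arg_cong[OF rank_nullity_bit[OF B], of real] by simp
  ultimately show ?thesis
    by (simp add: field_simps power2_eq_square)
qed

text \<open>The normalised sum is either 0 or exactly the bound, so the inequality follows from the
  equality.\<close>

lemma abs_quad_sum_le:
  assumes "w \<in> carrier_vec m"
  shows "\<bar>quad_sum m Q w\<bar> / 2 ^ m \<le> 1 / sqrt (2 ^ rank2 (Q + Q\<^sup>T))"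
    and "quad_sum m Q w \<noteq> 0 \<Longrightarrow> \<bar>quad_sum m Q w\<bar> / 2 ^ m = 1 / sqrt (2 ^ rank2 (Q + Q\<^sup>T))"
proof -
  show *: "\<bar>quad_sum m Q w\<bar> / 2 ^ m = 1 / sqrt (2 ^ rank2 (Q + Q\<^sup>T))" if "quad_sum m Q w \<noteq> 0"
    using arg_cong[OF quad_sum_square[OF assms that], of sqrt] by (simp add: real_sqrt_divide)
  show "\<bar>quad_sum m Q w\<bar> / 2 ^ m \<le> 1 / sqrt (2 ^ rank2 (Q + Q\<^sup>T))"
    using * by (cases "quad_sum m Q w = 0") simp_all
qed

text \<open>After exchanging the sums over \<open>w\<close> and \<open>v\<close>, orthogonality
  leaves only \<open>v = 0\<^sub>v m\<close>; the total is thus \<open>2 ^ m\<close>, and some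
  summand is nonzero.\<close>

lemma quad_sum_nonzero:
  obtains w where "w \<in> carrier_vec m" "quad_sum m Q w \<noteq> 0"
proof -
  let ?V = "carrier_vec m :: bit vec set"
  have "(\<Sum>w\<in>?V. quad_sum m Q w)
      = (\<Sum>v\<in>?V. \<Sum>w\<in>?V. bit_char (v \<bullet> (Q *\<^sub>v v)) * bit_char (v \<bullet> w))"
    unfolding quad_sum_def
    by (subst sum.swap) (auto intro!: sum.cong simp: bit_char_add comm_scalar_prod[of _ m])
  also have "\<dots> = (\<Sum>v\<in>?V. bit_char (v \<bullet> (Q *\<^sub>v v)) * (if v = 0\<^sub>v m then 2 ^ m else 0))"
    by (intro sum.cong) (auto simp: sum_bit_char_linear simp flip: sum_distrib_left)
  also have "\<dots> = (\<Sum>v\<in>?V. if v = 0\<^sub>v m then 2 ^ m else 0)"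
    using scalar_prod_left_zero[OF mult_mat_vec_carrier[OF Q zero_carrier_vec]]
    by (intro sum.cong) auto
  finally have "(\<Sum>w\<in>?V. quad_sum m Q w) \<noteq> 0" by simp
  then show thesis
    using that by (meson sum.not_neutral_contains_not_neutral)
qed

end

section \<open>Columns of the Golay spreading matrix\<close>

lemma quad_mat_carrier [simp]: "quad_mat m p \<in> carrier_mat m m"
  by (simp add: quad_mat_def)

lemma lin_form_eq_bits: "lin_form m c (digit i) = bits m c \<bullet> bits m i"
proof -
  have "lin_form m c (digit i) = (\<Sum>k<m. digit c (k + 1) * digit i (k + 1))"
    unfolding lin_form_def by (rule sum.reindex_bij_witness[of _ "\<lambda>k. k + 1" "\<lambda>r. r - 1"]) auto
  then show ?thesis
    by (simp add: bits_def scalar_prod_def lessThan_atLeast0)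
qed

text \<open>Multiplying signs adds exponents: the quadratic matrices add, and the linear labels add
  digitwise, which on numbers is \<open>xor\<close>.\<close>

lemma golay_vec_scalar_prod:
  assumes "p permutes {1..m}" "q permutes {1..m}"
  shows "golay_vec m p c \<bullet> golay_vec m q d
    = quad_sum m (quad_mat m p + quad_mat m q) (bits m (xor c d))"
proof -
  let ?Q = "quad_mat m p + quad_mat m q" and ?w = "bits m (xor c d)"
  have entry: "golay_vec m p' c' $ i
      = bit_char (bits m i \<bullet> (quad_mat m p' *\<^sub>v bits m i) + bits m c' \<bullet> bits m i)"
    if "i < 2 ^ m" "p' permutes {1..m}" for i p' c'
    using that quad_form_eq_quad_mat[OF that(2), of "digit i"]
    by (simp add: golay_vec_def bit_char_def lin_form_eq_bits bits_def)
  have "golay_vec m p c $ i * golay_vec m q d $ i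
      = bit_char (bits m i \<bullet> (?Q *\<^sub>v bits m i) + ?w \<bullet> bits m i)" if "i < 2 ^ m" for i
    unfolding entry[OF that assms(1)] entry[OF that assms(2)] bits_add[symmetric]
      add_mult_distrib_mat_vec[OF quad_mat_carrier quad_mat_carrier bits_carrier]
      add_scalar_prod_distrib[OF bits_carrier bits_carrier bits_carrier]
      scalar_prod_add_distrib[OF bits_carrier mult_mat_vec_carrier[OF quad_mat_carrier bits_carrier]
        mult_mat_vec_carrier[OF quad_mat_carrier bits_carrier]]
      bit_char_add
    by (simp only: ac_simps)
  then have "golay_vec m p c \<bullet> golay_vec m q d
      = (\<Sum>i<2 ^ m. bit_char (bits m i \<bullet> (?Q *\<^sub>v bits m i) + ?w \<bullet> bits m i))"
    by (simp add: scalar_prod_def golay_vec_def lessThan_atLeast0)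
  also have "\<dots> = quad_sum m ?Q ?w"
    unfolding quad_sum_def by (rule sum.reindex_bij_betw[OF bij_betw_bits])
  finally show ?thesis .
qed

lemma col_golay_spreading_matrix:
  assumes "j < L * 2 ^ m"
  shows "col (golay_spreading_matrix m L p) j
    = (1 / sqrt (2 ^ m)) \<cdot>\<^sub>v golay_vec m (p (j div 2 ^ m + 1)) (j mod 2 ^ m)"
  using assms
  by (intro eq_vecI)
    (auto simp: golay_spreading_matrix_def golay_block_def mat_of_cols_def golay_vec_def)

text \<open>The scalars \<open>1 / sqrt (2 ^ m)\<close> of the two columns combine to the division
  by \<open>2 ^ m\<close>.\<close>

lemma col_golay_scalar_prod:
  assumes p: "\<And>k. k \<in> {1..L} \<Longrightarrow> p k permutes {1..m}"
    and ij: "i < L * 2 ^ m" "j < L * 2 ^ m"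
  shows "col (golay_spreading_matrix m L p) i \<bullet> col (golay_spreading_matrix m L p) j
    = quad_sum m (quad_mat m (p (i div 2 ^ m + 1)) + quad_mat m (p (j div 2 ^ m + 1)))
        (bits m (xor (i mod 2 ^ m) (j mod 2 ^ m))) / 2 ^ m"
proof -
  have k: "i div 2 ^ m + 1 \<in> {1..L}" "j div 2 ^ m + 1 \<in> {1..L}"
    using ij by (auto simp: Suc_le_eq less_mult_imp_div_less)
  have "dim_vec (golay_vec m p' c) = 2 ^ m" for p' c
    by (simp add: golay_vec_def)
  then show ?thesis
    using golay_vec_scalar_prod[OF p[OF k(1)] p[OF k(2)], of "i mod 2 ^ m" "j mod 2 ^ m"]
    by (simp add: col_golay_spreading_matrix[OF ij(1)] col_golay_spreading_matrix[OF ij(2)])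
qed

lemma add_self_bit_mat: "A \<in> carrier_mat n k \<Longrightarrow> A + A = (0\<^sub>m n k :: bit mat)"
  by (intro eq_matI) auto

text \<open>Pairing a column with itself gives the zero quadratic matrix and the zero label, so the
  quadratic sum is \<open>2 ^ m\<close>.\<close>

lemma l2_norm_col_golay:
  assumes "\<And>k. k \<in> {1..L} \<Longrightarrow> p k permutes {1..m}" and "j < L * 2 ^ m"
  shows "l2_norm (col (golay_spreading_matrix m L p) j) = 1"
proof -
  have "bits m 0 = 0\<^sub>v m"
    by (intro eq_vecI) (auto simp: bits_def digit_def)
  then show ?thesis
    using col_golay_scalar_prod[OF assms assms(2)] quad_sum_zero_mat[of "0\<^sub>v m" m]
    by (simp add: l2_norm_def add_self_bit_mat[OF quad_mat_carrier])
qed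

section \<open>Coherence as a maximum of normalised quadratic sums\<close>

theorem theorem1:
  fixes m L r_min :: nat and p :: "nat \<Rightarrow> nat \<Rightarrow> nat"
  assumes "m \<ge> 1" and "L \<ge> 2"
    and "\<And>k. k \<in> {1..L} \<Longrightarrow> p k permutes {1..m}"
    and "inj_on p {1..L}"
    and "r_min = Min {rank2 (symplectic_mat m (p k1) (p k2)) | k1 k2.
           k1 \<in> {1..L} \<and> k2 \<in> {1..L} \<and> k1 \<noteq> k2}"
  shows "coherence (golay_spreading_matrix m L p) = 1 / sqrt (2 ^ r_min)"
proof -
  let ?A = "golay_spreading_matrix m L p"
  let ?N = "L * 2 ^ m"
  let ?Q = "\<lambda>k1 k2. quad_mat m (p k1) + quad_mat m (p k2)"
  let ?r = "\<lambda>k1 k2. rank2 (?Q k1 k2 + (?Q k1 k2)\<^sup>T)"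
  let ?R = "{?r k1 k2 | k1 k2. k1 \<in> {1..L} \<and> k2 \<in> {1..L} \<and> k1 \<noteq> k2}"
  let ?w = "\<lambda>i j. bits m (xor (i mod 2 ^ m) (j mod 2 ^ m))"
  let ?k = "\<lambda>i. i div 2 ^ m + 1"
  let ?S = "{\<bar>quad_sum m (?Q (?k i) (?k j)) (?w i j)\<bar> / 2 ^ m | i j. i < ?N \<and> j < ?N \<and> i \<noteq> j}"
  have Q: "?Q k1 k2 \<in> carrier_mat m m" for k1 k2
    by simp
  have r_min: "r_min = Min ?R"
    using assms(5) by (simp add: symplectic_mat_def Let_def)
  have "?R \<subseteq> (\<lambda>(k1, k2). ?r k1 k2) ` ({1..L} \<times> {1..L})"
    by auto
  then have finR: "finite ?R"
    by (rule finite_subset) simp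
  have "?r 1 2 \<in> ?R"
    using \<open>L \<ge> 2\<close> by (intro CollectI exI[of _ 1] exI[of _ 2]) auto
  then have neR: "?R \<noteq> {}"
    by blast
  have dim: "dim_col ?A = ?N"
    by (simp add: golay_spreading_matrix_def)
  \<comment> \<open>All columns have norm 1, so the denominators disappear.\<close>
  have "coherence ?A = Max ?S"
    unfolding coherence_def dim
    using col_golay_scalar_prod[of L p m, OF assms(3)] l2_norm_col_golay[of L p m, OF assms(3)]
    by (intro arg_cong[where f = Max] Collect_cong ex_cong1) (auto simp: abs_divide)
  also have "Max ?S = 1 / sqrt (2 ^ r_min)"
  proof (rule Max_eqI)
    have "?S \<subseteq> (\<lambda>(i, j). \<bar>quad_sum m (?Q (?k i) (?k j)) (?w i j)\<bar> / 2 ^ m) ` ({..<?N} \<times> {..<?N})"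
      by auto
    then show "finite ?S"
      by (rule finite_subset) simp
  next
    fix y assume "y \<in> ?S"
    then obtain i j where ij: "i < ?N" "j < ?N" "i \<noteq> j"
      and y: "y = \<bar>quad_sum m (?Q (?k i) (?k j)) (?w i j)\<bar> / 2 ^ m"
      by blast
    show "y \<le> 1 / sqrt (2 ^ r_min)"
    proof (cases "?k i = ?k j")
      case True
      then have "i mod 2 ^ m \<noteq> j mod 2 ^ m"
        using ij(3) by (metis add_right_cancel div_mult_mod_eq)
      then have "bits m (i mod 2 ^ m) \<noteq> bits m (j mod 2 ^ m)"
        using bij_betw_imp_inj_on[OF bij_betw_bits, of m] by (auto dest: inj_onD)
      \<comment> \<open>If the two label vectors had sum zero, adding the second one again would
        make them equal.\<close>
      then have "?w i j \<noteq> 0\<^sub>v m"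
        using add_add_self_bit_vec[of "bits m (i mod 2 ^ m)" m "bits m (j mod 2 ^ m)"]
        by (auto simp flip: bits_add)
      then have "y = 0"
        using True by (simp add: y add_self_bit_mat[OF quad_mat_carrier] quad_sum_zero_mat)
      then show ?thesis by simp
    next
      case False
      have "?k i \<in> {1..L}" "?k j \<in> {1..L}"
        using ij by (auto simp: Suc_le_eq less_mult_imp_div_less)
      with False have "r_min \<le> ?r (?k i) (?k j)"
        unfolding r_min by (intro Min_le finR) blast
      \<comment> \<open>A smaller rank gives a larger bound, so the minimal rank bounds all pairs of
        blocks.\<close>
      then have "1 / sqrt (2 ^ ?r (?k i) (?k j)) \<le> 1 / sqrt (2 ^ r_min)"
        by (intro divide_left_mono) auto
      then show ?thesis
        using abs_quad_sum_le(1)[OF Q, of "?w i j"] unfolding y by (meson bits_carrier order_trans)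
    qed
  next
    obtain k1 k2 where k: "k1 \<in> {1..L}" "k2 \<in> {1..L}" "k1 \<noteq> k2" and r: "r_min = ?r k1 k2"
      using Min_in[OF finR neR] unfolding r_min by blast
    obtain w where w: "w \<in> carrier_vec m" "quad_sum m (?Q k1 k2) w \<noteq> 0"
      using quad_sum_nonzero[OF Q] by blast
    obtain c where c: "c < 2 ^ m" "w = bits m c"
      using w(1) bij_betw_imp_surj_on[OF bij_betw_bits, of m] by auto
    \<comment> \<open>The columns with labels \<open>c\<close> and 0 in the blocks \<open>k1\<close>
      and \<open>k2\<close> have label sum \<open>w\<close>. Blocks are numbered from 1, so block
      \<open>k1\<close> starts at column \<open>(k1 - 1) * 2 ^ m\<close>.\<close>
    define i j where "i = (k1 - 1) * 2 ^ m + c" and "j = (k2 - 1) * 2 ^ m"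
    have kij: "?k i = k1" "?k j = k2" and wij: "?w i j = w"
      using k c by (auto simp: i_def j_def)
    have bound: "(k - 1) * 2 ^ m + d < ?N" if "k \<in> {1..L}" "d < 2 ^ m" for k d
    proof -
      have "(k - 1) * 2 ^ m + d < (k - 1) * 2 ^ m + 2 ^ m"
        using that by simp
      also have "\<dots> = k * 2 ^ m"
        using that by (cases k) auto
      also have "\<dots> \<le> ?N"
        using that by simp
      finally show ?thesis .
    qed
    have "i < ?N" "j < ?N"
      using bound[of k1 c] bound[of k2 0] k c by (auto simp: i_def j_def)
    moreover have "i \<noteq> j"
      using k(3) kij by metis
    moreover have "1 / sqrt (2 ^ r_min) = \<bar>quad_sum m (?Q (?k i) (?k j)) (?w i j)\<bar> / 2 ^ m"
      unfolding kij wij r using abs_quad_sum_le(2)[OF Q w] by simp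
    ultimately show "1 / sqrt (2 ^ r_min) \<in> ?S"
      by blast
  qed
  finally show ?thesis .
qed

end
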